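(* Let $J(p,q)=\langle p,\operatorname{Pr}_{\mathcal{C}}(\tfrac{p}{\gamma})\rangle_{L^2(\mathcal{O})}-\frac{\gamma}{2}\|\operatorname{Pr}_{\mathcal{C}}(\tfrac{p}{\gamma})\|^2_{L^2(\mathcal{O})}-\langle q,y_d\rangle_{L^2(Q)}+\frac12\|q\|^2_{L^2(Q)}$ be the objective functional of the dual problem, regarded as a function of the state variable $p\in L^2(\mathcal{O})$ and the control variable $q\in L^2(Q)$. Then $J$ is Gâteaux differentiable with respect to the state variable $p$ and with respect to the control variable $q$, respectively (i.e. $p\mapsto J(p,q)$ is Gâteaux differentiable on $L^2(\mathcal{O})$ for each fixed $q$, and $q\mapsto J(p,q)$ is Gâteaux differentiable on $L^2(Q)$ for each fixed $p$).
   Context: $\Omega\subset\mathbb{R}^n$ is a domain, $0<T<\infty$, $Q=\Omega\times(0,T)$, $O\subset\Omega$ is open and $\mathcal{O}=O\times(0,T)$. $\gamma>0$ is a constant, $y_d\in L^2(Q)$ is given, and $a\le 0\le b$ are real constants. The set $\mathcal{C}=\{u\in L^2(\mathcal{O}) : a\le u(x,t)\le b \text{ a.e. in } \mathcal{O}\}$, and $\operatorname{Pr}_{\mathcal{C}}$ is the $L^2(\mathcal{O})$-projection onto $\mathcal{C}$, i.e. the pointwise truncation $\operatorname{Pr}_{\mathcal{C}}(v)(x,t)=\min\{b,\max\{a,v(x,t)\}\}$. *)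

theory Defs
  imports "HOL-Analysis.Analysis"
begin

text \<open>
  Elements of \<open>L\<^sup>2\<close> are represented by square-integrable functions; two representatives that agree
  almost everywhere denote the same element. All notions below respect this identification:
  see \<open>dual_objective_cong\<close> for the functional, and note that a linear functional that is bounded
  with respect to the seminorm \<open>L2_norm\<close> takes equal values on almost everywhere equal arguments.
\<close>

definition L2 :: "'a measure \<Rightarrow> ('a \<Rightarrow> real) set" where
  "L2 M = {f \<in> borel_measurable M. integrable M (\<lambda>z. (f z)\<^sup>2)}"

definition L2_inner :: "'a measure \<Rightarrow> ('a \<Rightarrow> real) \<Rightarrow> ('a \<Rightarrow> real) \<Rightarrow> real" where
  "L2_inner M f g = (LINT z|M. f z * g z)"

definition L2_norm :: "'a measure \<Rightarrow> ('a \<Rightarrow> real) \<Rightarrow> real" where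
  "L2_norm M f = sqrt (L2_inner M f f)"

definition L2_bounded_linear :: "'a measure \<Rightarrow> (('a \<Rightarrow> real) \<Rightarrow> real) \<Rightarrow> bool" where
  "L2_bounded_linear M D \<longleftrightarrow>
     (\<forall>f\<in>L2 M. \<forall>g\<in>L2 M. D (\<lambda>z. f z + g z) = D f + D g) \<and>
     (\<forall>c. \<forall>f\<in>L2 M. D (\<lambda>z. c * f z) = c * D f) \<and>
     (\<exists>K. \<forall>f\<in>L2 M. \<bar>D f\<bar> \<le> K * L2_norm M f)"

definition L2_gateaux_differentiable_at ::
    "'a measure \<Rightarrow> (('a \<Rightarrow> real) \<Rightarrow> real) \<Rightarrow> ('a \<Rightarrow> real) \<Rightarrow> bool" where
  "L2_gateaux_differentiable_at M F p \<longleftrightarrow>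
     (\<exists>D. L2_bounded_linear M D \<and>
       (\<forall>h\<in>L2 M. ((\<lambda>t. (F (\<lambda>z. p z + t * h z) - F p) / t) \<longlongrightarrow> D h) (at 0)))"

definition L2_gateaux_differentiable :: "'a measure \<Rightarrow> (('a \<Rightarrow> real) \<Rightarrow> real) \<Rightarrow> bool" where
  "L2_gateaux_differentiable M F \<longleftrightarrow> (\<forall>p\<in>L2 M. L2_gateaux_differentiable_at M F p)"

definition cylinder :: "(real ^ 'n) set \<Rightarrow> real \<Rightarrow> ((real ^ 'n) \<times> real) measure" where
  "cylinder S T = lebesgue_on (S \<times> {0<..<T})"

definition box_constraints :: "'a measure \<Rightarrow> real \<Rightarrow> real \<Rightarrow> ('a \<Rightarrow> real) set" where
  "box_constraints M a b = {u \<in> L2 M. AE z in M. a \<le> u z \<and> u z \<le> b}"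

text \<open>
  The projection onto \<open>box_constraints M a b\<close>, given by pointwise truncation. That this is the
  metric projection of \<open>L\<^sup>2\<close> is \<open>Pr_in_box_constraints\<close>, \<open>Pr_nearest\<close> and \<open>Pr_unique\<close>.
\<close>

definition Pr :: "real \<Rightarrow> real \<Rightarrow> ('a \<Rightarrow> real) \<Rightarrow> 'a \<Rightarrow> real" where
  "Pr a b v = (\<lambda>z. min b (max a (v z)))"

definition dual_objective ::
    "(real ^ 'n) set \<Rightarrow> (real ^ 'n) set \<Rightarrow> real \<Rightarrow> real \<Rightarrow> real \<Rightarrow> real \<Rightarrow>
     ((real ^ 'n) \<times> real \<Rightarrow> real) \<Rightarrow> ((real ^ 'n) \<times> real \<Rightarrow> real) \<Rightarrow> ((real ^ 'n) \<times> real \<Rightarrow> real) \<Rightarrow> real"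
  where
  "dual_objective \<Omega> U T \<gamma> a b y\<^sub>d p q =
     L2_inner (cylinder U T) p (Pr a b (\<lambda>z. p z / \<gamma>))
     - \<gamma> / 2 * (L2_norm (cylinder U T) (Pr a b (\<lambda>z. p z / \<gamma>)))\<^sup>2
     - L2_inner (cylinder \<Omega> T) q y\<^sub>d
     + 1 / 2 * (L2_norm (cylinder \<Omega> T) q)\<^sup>2"

lemma L2_diff:
  assumes "f \<in> L2 M" "g \<in> L2 M"
  shows "(\<lambda>z. f z - g z) \<in> L2 M"
proof -
  have [measurable]: "f \<in> borel_measurable M" "g \<in> borel_measurable M"
    and int: "integrable M (\<lambda>z. (f z)\<^sup>2)" "integrable M (\<lambda>z. (g z)\<^sup>2)"
    using assms by (auto simp: L2_def)
  have "(f z - g z)\<^sup>2 \<le> 2 * (f z)\<^sup>2 + 2 * (g z)\<^sup>2" for z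
    using zero_le_power2[of "f z + g z"] by (simp add: power2_eq_square algebra_simps)
  then have bound: "AE z in M. norm ((f z - g z)\<^sup>2) \<le> norm (2 * (f z)\<^sup>2 + 2 * (g z)\<^sup>2)"
    by (intro AE_I2) simp
  have dominating: "integrable M (\<lambda>z. 2 * (f z)\<^sup>2 + 2 * (g z)\<^sup>2)"
    using int by simp
  have "(\<lambda>z. (f z - g z)\<^sup>2) \<in> borel_measurable M"
    by measurable
  from Bochner_Integration.integrable_bound[OF dominating this bound]
  have "integrable M (\<lambda>z. (f z - g z)\<^sup>2)" .
  then show ?thesis by (simp add: L2_def)
qed

lemma abs_truncation_le:
  fixes a b x :: real
  assumes "a \<le> 0" "0 \<le> b"
  shows "\<bar>min b (max a x)\<bar> \<le> \<bar>x\<bar>"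
  using assms by linarith

lemma truncation_nearest:
  fixes a b x y :: real
  assumes "a \<le> y" "y \<le> b"
  shows "\<bar>x - min b (max a x)\<bar> \<le> \<bar>x - y\<bar>"
  using assms by linarith

lemma truncation_unique:
  fixes a b x y :: real
  assumes "a \<le> y" "y \<le> b" "\<bar>x - y\<bar> = \<bar>x - min b (max a x)\<bar>"
  shows "y = min b (max a x)"
  using assms by linarith

lemma Pr_in_box_constraints:
  assumes "a \<le> 0" "0 \<le> b" "v \<in> L2 M"
  shows "Pr a b v \<in> box_constraints M a b"
proof -
  have [measurable]: "v \<in> borel_measurable M" and int: "integrable M (\<lambda>z. (v z)\<^sup>2)"
    using assms by (auto simp: L2_def)
  have "(min b (max a (v z)))\<^sup>2 \<le> (v z)\<^sup>2" for z
    unfolding abs_le_square_iff[symmetric] by (rule abs_truncation_le[OF assms(1,2)])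
  then have "integrable M (\<lambda>z. (min b (max a (v z)))\<^sup>2)"
    using int by (intro Bochner_Integration.integrable_bound[OF int]) auto
  then show ?thesis
    using assms by (auto simp: box_constraints_def L2_def Pr_def)
qed

lemma Pr_nearest:
  assumes "a \<le> 0" "0 \<le> b" "v \<in> L2 M" "u \<in> box_constraints M a b"
  shows "L2_norm M (\<lambda>z. v z - Pr a b v z) \<le> L2_norm M (\<lambda>z. v z - u z)"
proof -
  have "Pr a b v \<in> L2 M" "u \<in> L2 M" and u: "AE z in M. a \<le> u z \<and> u z \<le> b"
    using assms Pr_in_box_constraints[of a b v M] by (auto simp: box_constraints_def)
  then have "integrable M (\<lambda>z. (v z - Pr a b v z)\<^sup>2)" "integrable M (\<lambda>z. (v z - u z)\<^sup>2)"
    using L2_diff[of v M] assms by (auto simp: L2_def)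
  moreover have "AE z in M. (v z - Pr a b v z)\<^sup>2 \<le> (v z - u z)\<^sup>2"
    using u
    by eventually_elim (simp add: abs_le_square_iff[symmetric] Pr_def truncation_nearest)
  ultimately show ?thesis
    unfolding L2_norm_def L2_inner_def
    by (auto simp: power2_eq_square intro!: integral_mono_AE)
qed

lemma Pr_unique:
  assumes "a \<le> 0" "0 \<le> b" "v \<in> L2 M" "u \<in> box_constraints M a b"
    and le: "L2_norm M (\<lambda>z. v z - u z) \<le> L2_norm M (\<lambda>z. v z - Pr a b v z)"
  shows "AE z in M. u z = Pr a b v z"
proof -
  have P: "Pr a b v \<in> L2 M" "u \<in> L2 M" and u: "AE z in M. a \<le> u z \<and> u z \<le> b"
    using assms Pr_in_box_constraints[of a b v M] by (auto simp: box_constraints_def)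
  then have int: "integrable M (\<lambda>z. (v z - Pr a b v z)\<^sup>2)" "integrable M (\<lambda>z. (v z - u z)\<^sup>2)"
    using L2_diff[of v M] assms by (auto simp: L2_def)
  let ?d = "\<lambda>z. (v z - u z)\<^sup>2 - (v z - Pr a b v z)\<^sup>2"
  have d: "integrable M ?d" using int by simp
  have nonneg: "AE z in M. 0 \<le> ?d z"
    using u
    by eventually_elim (simp add: abs_le_square_iff[symmetric] Pr_def truncation_nearest)
  have "integral\<^sup>L M ?d \<le> 0"
    using le int by (simp add: L2_norm_def L2_inner_def power2_eq_square)
  then have "integral\<^sup>L M ?d = 0"
    using integral_nonneg_AE[OF nonneg] by linarith
  then have "AE z in M. ?d z = 0"
    using integral_nonneg_eq_0_iff_AE[OF d nonneg] by simp
  with u show ?thesis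
  proof eventually_elim
    case (elim z)
    then have "\<bar>v z - u z\<bar> = \<bar>v z - Pr a b v z\<bar>"
      by (simp add: power2_eq_iff abs_eq_iff)
    with elim(1) show ?case
      unfolding Pr_def by (intro truncation_unique) auto
  qed
qed

lemma dual_objective_cong:
  assumes "p \<in> L2 (cylinder U T)" "p' \<in> L2 (cylinder U T)" "AE z in cylinder U T. p z = p' z"
    and "q \<in> L2 (cylinder \<Omega> T)" "q' \<in> L2 (cylinder \<Omega> T)" "AE z in cylinder \<Omega> T. q z = q' z"
    and "y\<^sub>d \<in> L2 (cylinder \<Omega> T)"
  shows "dual_objective \<Omega> U T \<gamma> a b y\<^sub>d p q = dual_objective \<Omega> U T \<gamma> a b y\<^sub>d p' q'"
proof -
  note [measurable] = assms(1,2,4,5,7)[unfolded L2_def, THEN CollectD, THEN conjunct1]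
  show ?thesis
    unfolding dual_objective_def L2_norm_def L2_inner_def Pr_def
    using assms(3,6)
    by (intro arg_cong2[where f="(+)"] arg_cong2[where f="(-)"] arg_cong2[where f="(*)"]
        arg_cong[where f="\<lambda>x. (sqrt x)\<^sup>2"] refl integral_cong_AE) auto
qed

end

theory Submission
  imports Defs
begin

text \<open>
  With \<open>\<pi> v = min b (max a v)\<close>, the integrand \<open>s * \<pi> (s / \<gamma>) - \<gamma> / 2 * (\<pi> (s / \<gamma>))\<^sup>2\<close> is the
  maximum of \<open>s * u - \<gamma> / 2 * u\<^sup>2\<close> over \<open>u \<in> {a..b}\<close>, attained at \<open>u = \<pi> (s / \<gamma>)\<close>. Hence
  \<open>\<pi> (s / \<gamma>)\<close> is a subgradient at \<open>s\<close>, and since \<open>\<pi>\<close> is nonexpansive, the remainder of the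
  first-order expansion lies between \<open>0\<close> and \<open>(s' - s)\<^sup>2 / \<gamma>\<close>. Integration gives a remainder
  \<open>O(t\<^sup>2)\<close> along every line, so \<open>J\<close> has the \<open>p\<close>-gradient \<open>Pr a b (p / \<gamma>)\<close>. In \<open>q\<close> the functional is
  quadratic with gradient \<open>q - y\<^sub>d\<close>.
\<close>

lemma L2_cmult:
  assumes "f \<in> L2 M"
  shows "(\<lambda>z. c * f z) \<in> L2 M"
  using assms by (auto simp: L2_def power_mult_distrib)

lemma L2_add:
  assumes "f \<in> L2 M" "g \<in> L2 M"
  shows "(\<lambda>z. f z + g z) \<in> L2 M"
  using L2_diff[OF assms(1) L2_cmult[OF assms(2), of "-1"]] by simp

lemma L2_divide:
  assumes "f \<in> L2 M"
  shows "(\<lambda>z. f z / c) \<in> L2 M"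
  using L2_cmult[OF assms, of "inverse c"] by (simp add: field_simps)

lemma Pr_in_L2:
  assumes "a \<le> 0" "0 \<le> b" "v \<in> L2 M"
  shows "Pr a b v \<in> L2 M"
  using Pr_in_box_constraints[OF assms] by (simp add: box_constraints_def)

text \<open>Polarization: the product is half of (f + g)^2 - f^2 - g^2, and \<open>L2_add\<close>
  makes all three squares integrable.\<close>

lemma L2_mult_integrable:
  assumes "f \<in> L2 M" "g \<in> L2 M"
  shows "integrable M (\<lambda>z. f z * g z)"
proof -
  have "integrable M (\<lambda>z. ((f z + g z)\<^sup>2 - (f z)\<^sup>2 - (g z)\<^sup>2) / 2)"
    using assms L2_add[OF assms] unfolding L2_def
    by (intro integrable_divide Bochner_Integration.integrable_diff) auto
  then show ?thesis by (simp add: power2_sum)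
qed

lemma L2_norm_square: "(L2_norm M f)\<^sup>2 = L2_inner M f f"
  unfolding L2_norm_def L2_inner_def by (intro real_sqrt_pow2 integral_nonneg_AE) auto

lemma L2_inner_add_left:
  assumes "f \<in> L2 M" "g \<in> L2 M" "h \<in> L2 M"
  shows "L2_inner M (\<lambda>z. f z + g z) h = L2_inner M f h + L2_inner M g h"
  using assms by (simp add: L2_inner_def distrib_right L2_mult_integrable)

lemma L2_inner_cmult_left: "L2_inner M (\<lambda>z. c * f z) h = c * L2_inner M f h"
  by (simp add: L2_inner_def mult.assoc)

lemma L2_norm_square_add_cmult:
  assumes "f \<in> L2 M" "g \<in> L2 M"
  shows "(L2_norm M (\<lambda>z. f z + t * g z))\<^sup>2
    = (L2_norm M f)\<^sup>2 + 2 * t * L2_inner M f g + t\<^sup>2 * (L2_norm M g)\<^sup>2"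
proof -
  have "(L2_norm M (\<lambda>z. f z + t * g z))\<^sup>2
      = (LINT z|M. f z * f z + 2 * t * (f z * g z) + t\<^sup>2 * (g z * g z))"
    unfolding L2_norm_square L2_inner_def
    by (intro Bochner_Integration.integral_cong) (auto simp: algebra_simps power2_eq_square)
  also have "\<dots> = (L2_norm M f)\<^sup>2 + 2 * t * L2_inner M f g + t\<^sup>2 * (L2_norm M g)\<^sup>2"
    using assms by (simp add: L2_mult_integrable L2_norm_square L2_inner_def)
  finally show ?thesis .
qed

text \<open>For A > 0, A times the value at the minimizer - B / A is A * C - B^2. The degenerate
  case A = 0 is included so that Cauchy-Schwarz also covers functions of seminorm zero.\<close>

lemma nonneg_quadratic_discriminant:
  fixes A B C :: real
  assumes "0 \<le> A" and nonneg: "\<And>t. 0 \<le> A * t\<^sup>2 + 2 * B * t + C"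
  shows "B\<^sup>2 \<le> A * C"
proof (cases "A = 0")
  case True
  then have "B = 0"
    \<comment> \<open>If A = 0 and B were nonzero, the polynomial would take the value -1 at this
      point.\<close>
    using nonneg[of "- (C + 1) / (2 * B)"] by (auto split: if_splits)
  then show ?thesis
    using True by simp
next
  case False
  have "A * (A * (- B / A)\<^sup>2 + 2 * B * (- B / A) + C) = A * C - B\<^sup>2"
    using False by (simp add: power2_eq_square field_simps)
  then show ?thesis
    using mult_nonneg_nonneg[OF assms(1) nonneg[of "- B / A"]] by simp
qed

text \<open>The squared norm of f + t * g is a quadratic in t that is never negative, so its
  discriminant bound is the squared inequality.\<close>

lemma L2_Cauchy_Schwarz:
  assumes "f \<in> L2 M" "g \<in> L2 M"
  shows "\<bar>L2_inner M f g\<bar> \<le> L2_norm M f * L2_norm M g"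
proof -
  have "0 \<le> (L2_norm M g)\<^sup>2 * t\<^sup>2 + 2 * L2_inner M f g * t + (L2_norm M f)\<^sup>2" for t
    using L2_norm_square_add_cmult[OF assms, of t]
      zero_le_power2[of "L2_norm M (\<lambda>z. f z + t * g z)"] by (simp add: algebra_simps)
  then have "(L2_inner M f g)\<^sup>2 \<le> (L2_norm M g)\<^sup>2 * (L2_norm M f)\<^sup>2"
    by (intro nonneg_quadratic_discriminant) auto
  then have "(L2_inner M f g)\<^sup>2 \<le> (L2_norm M f * L2_norm M g)\<^sup>2"
    by (simp add: power_mult_distrib mult.commute)
  moreover have "0 \<le> L2_norm M f * L2_norm M g"
    by (simp add: L2_norm_def L2_inner_def)
  ultimately show ?thesis
    by (simp add: abs_le_square_iff[symmetric])
qed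

lemma L2_bounded_linear_inner:
  assumes "g \<in> L2 M"
  shows "L2_bounded_linear M (\<lambda>h. L2_inner M h g)"
  unfolding L2_bounded_linear_def
  using assms L2_Cauchy_Schwarz[OF _ assms]
  by (auto simp: L2_inner_add_left L2_inner_cmult_left mult.commute
      intro!: exI[of _ "L2_norm M g"])

text \<open>Dividing the remainder by t leaves an error of at most
  \<open>C h * \<bar>t\<bar>\<close>, which tends to 0. The constant may depend on the direction
  \<open>h\<close>, since each limit is taken along a single line. Both halves of the theorem reduce
  to this criterion.\<close>

lemma L2_gateaux_differentiable_at_quadratic_remainder:
  assumes "g \<in> L2 M"
    and remainder: "\<And>h t. h \<in> L2 M \<Longrightarrow>
      \<bar>F (\<lambda>z. p z + t * h z) - F p - t * L2_inner M h g\<bar> \<le> C h * t\<^sup>2"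
  shows "L2_gateaux_differentiable_at M F p"
  unfolding L2_gateaux_differentiable_at_def
proof (intro exI[of _ "\<lambda>h. L2_inner M h g"] conjI ballI L2_bounded_linear_inner assms(1))
  fix h assume h: "h \<in> L2 M"
  let ?Q = "\<lambda>t. (F (\<lambda>z. p z + t * h z) - F p) / t"
  have "\<bar>?Q t - L2_inner M h g\<bar> \<le> C h * \<bar>t\<bar>" if "t \<noteq> 0" for t
  proof -
    have "\<bar>t\<bar> * \<bar>?Q t - L2_inner M h g\<bar> = \<bar>F (\<lambda>z. p z + t * h z) - F p - t * L2_inner M h g\<bar>"
      using that by (simp flip: abs_mult add: right_diff_distrib diff_divide_distrib)
    also have "\<dots> \<le> \<bar>t\<bar> * (C h * \<bar>t\<bar>)"
      using remainder[OF h, of t] by (simp add: power2_eq_square algebra_simps)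
    finally show ?thesis
      using that by simp
  qed
  then have "eventually (\<lambda>t. norm (?Q t - L2_inner M h g) \<le> C h * \<bar>t\<bar>) (at 0)"
    by (simp add: eventually_at_filter)
  moreover have "((\<lambda>t. C h * \<bar>t\<bar>) \<longlongrightarrow> 0) (at 0)"
    by (auto intro!: tendsto_eq_intros)
  ultimately have "((\<lambda>t. ?Q t - L2_inner M h g) \<longlongrightarrow> 0) (at 0)"
    by (rule Lim_null_comparison)
  then show "(?Q \<longlongrightarrow> L2_inner M h g) (at 0)"
    by (simp add: LIM_zero_iff)
qed

text \<open>Completing the square turns the maximization over u into finding the point of the
  interval nearest to s / \<gamma>, which is the truncation.\<close>

lemma truncation_maximizes:
  fixes \<gamma> a b s u :: real
  assumes "0 < \<gamma>" "a \<le> u" "u \<le> b"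
  shows "s * u - \<gamma> / 2 * u\<^sup>2
    \<le> s * min b (max a (s / \<gamma>)) - \<gamma> / 2 * (min b (max a (s / \<gamma>)))\<^sup>2"
proof -
  have complete_square: "s * w - \<gamma> / 2 * w\<^sup>2 = s\<^sup>2 / (2 * \<gamma>) - \<gamma> / 2 * (s / \<gamma> - w)\<^sup>2" for w
    using assms(1) by (simp add: power2_eq_square field_simps)
  have "(s / \<gamma> - min b (max a (s / \<gamma>)))\<^sup>2 \<le> (s / \<gamma> - u)\<^sup>2"
    using truncation_nearest[OF assms(2,3), of "s / \<gamma>"] by (simp add: abs_le_square_iff)
  with assms(1) show ?thesis
    unfolding complete_square by simp
qed

lemma truncation_remainder:
  fixes \<gamma> a b s d :: real
  assumes "0 < \<gamma>" "a \<le> b"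
  defines "w \<equiv> \<lambda>s. min b (max a (s / \<gamma>))"
  defines "\<phi> \<equiv> \<lambda>s. s * w s - \<gamma> / 2 * (w s)\<^sup>2"
  shows "\<bar>\<phi> (s + d) - \<phi> s - d * w s\<bar> \<le> d\<^sup>2 / \<gamma>"
proof -
  have "a \<le> w s" "w s \<le> b" for s
    using assms(2) by (auto simp: w_def)
  then have max: "x * w y - \<gamma> / 2 * (w y)\<^sup>2 \<le> \<phi> x" for x y
    unfolding \<phi>_def using truncation_maximizes[OF assms(1), of a "w y" b x] by (simp add: w_def)
  \<comment> \<open>At s + d, the old maximizer \<open>w s\<close> is only a competitor.\<close>
  have lower: "0 \<le> \<phi> (s + d) - \<phi> s - d * w s"
    using max[of "s + d" s] by (simp add: \<phi>_def algebra_simps)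
  \<comment> \<open>Roles exchanged: at s, the new maximizer \<open>w (s + d)\<close> is only a
    competitor.\<close>
  have "\<phi> (s + d) - \<phi> s - d * w s \<le> d * (w (s + d) - w s)"
    using max[of s "s + d"] by (simp add: \<phi>_def algebra_simps)
  also have "\<dots> \<le> \<bar>d\<bar> * \<bar>w (s + d) - w s\<bar>"
    by (simp add: abs_mult[symmetric])
  \<comment> \<open>Truncation to an interval is 1-Lipschitz.\<close>
  also have "\<dots> \<le> \<bar>d\<bar> * \<bar>(s + d) / \<gamma> - s / \<gamma>\<bar>"
    unfolding w_def by (intro mult_left_mono) auto
  also have "\<dots> = d\<^sup>2 / \<gamma>"
    using assms(1) by (simp add: add_divide_distrib power2_eq_square)
  finally show ?thesis
    using lower by simp
qed

text \<open>\<open>G\<close> collects the terms of the dual objective that depend on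
  \<open>p\<close>. The pointwise estimate with increment d = t * h z is integrated over
  \<open>M\<close>.\<close>

lemma truncated_functional_remainder:
  fixes \<gamma> a b t :: real
  assumes "0 < \<gamma>" "a \<le> 0" "0 \<le> b" "p \<in> L2 M" "h \<in> L2 M"
  defines "G \<equiv> \<lambda>p. L2_inner M p (Pr a b (\<lambda>z. p z / \<gamma>))
     - \<gamma> / 2 * (L2_norm M (Pr a b (\<lambda>z. p z / \<gamma>)))\<^sup>2"
  shows "\<bar>G (\<lambda>z. p z + t * h z) - G p - t * L2_inner M h (Pr a b (\<lambda>z. p z / \<gamma>))\<bar>
    \<le> (L2_norm M h)\<^sup>2 / \<gamma> * t\<^sup>2"
proof -
  define w where "w s = min b (max a (s / \<gamma>))" for s
  define \<phi> where "\<phi> s = s * w s - \<gamma> / 2 * (w s)\<^sup>2" for s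
  \<comment> \<open>Since a \<le> 0 \<le> b, truncation does not increase absolute values, so square
    integrability survives even when \<open>M\<close> has infinite total measure.\<close>
  have w: "(\<lambda>z. w (v z)) \<in> L2 M" if "v \<in> L2 M" for v
    using Pr_in_L2[OF assms(2,3) L2_divide[OF that]] by (simp add: Pr_def w_def)
  have \<phi>: "integrable M (\<lambda>z. \<phi> (v z))" and G: "G v = (LINT z|M. \<phi> (v z))" if "v \<in> L2 M" for v
    using that w[OF that] L2_mult_integrable[OF that w[OF that]]
      L2_mult_integrable[OF w[OF that] w[OF that]]
    by (simp_all add: \<phi>_def power2_eq_square G_def L2_norm_square[unfolded power2_eq_square]
        L2_inner_def Pr_def flip: w_def)
  let ?v = "\<lambda>z. p z + t * h z"
  let ?r = "\<lambda>z. \<phi> (?v z) - \<phi> (p z) - t * (h z * w (p z))"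
  have v: "?v \<in> L2 M"
    using assms by (intro L2_add L2_cmult)
  note int = \<phi>[OF v] \<phi>[OF assms(4)] L2_mult_integrable[OF assms(5) w[OF assms(4)]]
  have bound: "\<bar>?r z\<bar> \<le> t\<^sup>2 / \<gamma> * (h z * h z)" for z
    using truncation_remainder[of \<gamma> a b "p z" "t * h z"] assms(1-3)
    by (simp add: \<phi>_def w_def power2_eq_square algebra_simps)
  have "G ?v - G p - t * L2_inner M h (Pr a b (\<lambda>z. p z / \<gamma>)) = (LINT z|M. ?r z)"
    using int by (simp add: G[OF v] G[OF assms(4)] L2_inner_def Pr_def flip: w_def)
  also have "\<bar>\<dots>\<bar> \<le> (LINT z|M. \<bar>?r z\<bar>)"
    by (rule integral_abs_bound)
  also have "\<dots> \<le> (LINT z|M. t\<^sup>2 / \<gamma> * (h z * h z))"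
    using int L2_mult_integrable[OF assms(5,5)] bound by (intro integral_mono) auto
  also have "\<dots> = (L2_norm M h)\<^sup>2 / \<gamma> * t\<^sup>2"
    by (simp add: L2_norm_square L2_inner_def)
  finally show ?thesis .
qed

theorem theorem2p2:
  fixes \<Omega> U :: "(real ^ 'n) set"
    and T \<gamma> a b :: real
    and y\<^sub>d :: "(real ^ 'n) \<times> real \<Rightarrow> real"
  assumes "open \<Omega>" "connected \<Omega>" "\<Omega> \<noteq> {}"
    and "0 < T"
    and "open U" "U \<subseteq> \<Omega>"
    and "0 < \<gamma>"
    and "y\<^sub>d \<in> L2 (cylinder \<Omega> T)"
    and "a \<le> 0" "0 \<le> b"
  shows "(\<forall>q \<in> L2 (cylinder \<Omega> T).
            L2_gateaux_differentiable (cylinder U T) (\<lambda>p. dual_objective \<Omega> U T \<gamma> a b y\<^sub>d p q))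
       \<and> (\<forall>p \<in> L2 (cylinder U T).
            L2_gateaux_differentiable (cylinder \<Omega> T) (\<lambda>q. dual_objective \<Omega> U T \<gamma> a b y\<^sub>d p q))"
proof (intro conjI ballI; unfold L2_gateaux_differentiable_def; intro ballI)
  fix q p
  assume p: "p \<in> L2 (cylinder U T)"
  show "L2_gateaux_differentiable_at (cylinder U T) (\<lambda>p. dual_objective \<Omega> U T \<gamma> a b y\<^sub>d p q) p"
  proof (rule L2_gateaux_differentiable_at_quadratic_remainder)
    show "Pr a b (\<lambda>z. p z / \<gamma>) \<in> L2 (cylinder U T)"
      using assms p by (intro Pr_in_L2 L2_divide)
  next
    fix h t
    assume "h \<in> L2 (cylinder U T)"
    \<comment> \<open>The terms in \<open>q\<close> alone cancel in the difference, leaving exactly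
      the increment of the truncated functional.\<close>
    from truncated_functional_remainder[OF \<open>0 < \<gamma>\<close> \<open>a \<le> 0\<close> \<open>0 \<le> b\<close> p this, of t]
    show "\<bar>dual_objective \<Omega> U T \<gamma> a b y\<^sub>d (\<lambda>z. p z + t * h z) q - dual_objective \<Omega> U T \<gamma> a b y\<^sub>d p q
        - t * L2_inner (cylinder U T) h (Pr a b (\<lambda>z. p z / \<gamma>))\<bar>
      \<le> (L2_norm (cylinder U T) h)\<^sup>2 / \<gamma> * t\<^sup>2"
      by (simp add: dual_objective_def)
  qed
next
  fix p q
  assume q: "q \<in> L2 (cylinder \<Omega> T)"
  show "L2_gateaux_differentiable_at (cylinder \<Omega> T) (\<lambda>q. dual_objective \<Omega> U T \<gamma> a b y\<^sub>d p q) q"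
  proof (rule L2_gateaux_differentiable_at_quadratic_remainder)
    show "(\<lambda>z. q z - y\<^sub>d z) \<in> L2 (cylinder \<Omega> T)"
      using q assms(8) by (rule L2_diff)
    fix h t
    assume h: "h \<in> L2 (cylinder \<Omega> T)"
    have grad: "L2_inner (cylinder \<Omega> T) h (\<lambda>z. q z - y\<^sub>d z)
        = L2_inner (cylinder \<Omega> T) q h - L2_inner (cylinder \<Omega> T) h y\<^sub>d"
      using L2_mult_integrable[OF q h] L2_mult_integrable[OF h assms(8)]
      by (simp add: L2_inner_def right_diff_distrib mult.commute)
    have linear: "L2_inner (cylinder \<Omega> T) (\<lambda>z. q z + t * h z) y\<^sub>d
        = L2_inner (cylinder \<Omega> T) q y\<^sub>d + t * L2_inner (cylinder \<Omega> T) h y\<^sub>d"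
      using L2_inner_add_left[OF q L2_cmult[OF h] assms(8)] by (simp add: L2_inner_cmult_left)
    \<comment> \<open>After expanding the square, the first-order terms cancel against the gradient;
      what remains is exactly half of t^2 times the squared norm of \<open>h\<close>, so the bound
      holds with equality.\<close>
    show "\<bar>dual_objective \<Omega> U T \<gamma> a b y\<^sub>d p (\<lambda>z. q z + t * h z)
        - dual_objective \<Omega> U T \<gamma> a b y\<^sub>d p q
        - t * L2_inner (cylinder \<Omega> T) h (\<lambda>z. q z - y\<^sub>d z)\<bar>
      \<le> (L2_norm (cylinder \<Omega> T) h)\<^sup>2 / 2 * t\<^sup>2"
      unfolding dual_objective_def L2_norm_square_add_cmult[OF q h] grad linear
      by (simp add: algebra_simps)
  qed
qed

end
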